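(* Let $R$ be a unital ring with involution $*$, let $a\in R$ and let $n$ be a positive integer. Then the following conditions are equivalent: (1) $a\in R^{\dagger}$; (2) $R=a^{\circ}\oplus (a^{*}a)^{n}R$; (3) $R=a^{\circ}+ (a^{*}a)^{n}R$; (4) $R=(a^{*})^{\circ}\oplus (aa^{*})^{n}R$; (5) $R=(a^{*})^{\circ}+ (aa^{*})^{n}R$; (6) $R={}^{\circ}a\oplus R(aa^{*})^{n}$; (7) $R={}^{\circ}a+ R(aa^{*})^{n}$; (8) $R={}^{\circ}(a^{*})\oplus R(a^{*}a)^{n}$; (9) $R={}^{\circ}(a^{*})+ R(a^{*}a)^{n}$.
   Context: $R$ is a unital ring with an involution $a\mapsto a^*$, i.e. $(a^* )^*=a$, $(ab)^*=b^*a^*$, $(a+b)^*=a^*+b^*$. $R^{\dagger}$ is the set of Moore-Penrose invertible elements, i.e. those $a$ for which there is $b\in R$ with $aba=a$, $bab=b$, $(ab)^*=ab$, $(ba)^*=ba$. For $c\in R$: $cR=\{cx\mid x\in R\}$, $Rc=\{xc\mid x\in R\}$, ${}^{\circ}c=\{x\in R\mid xc=0\}$, $c^{\circ}=\{x\in R\mid cx=0\}$. Sums are sums of additive subgroups (one-sided ideals) of $R$, and $\oplus$ denotes an internal direct sum (the sum with trivial intersection). *)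

theory Defs
  imports Main "HOL-Library.Set_Algebras"
begin

(* The superclasses are ring and monoid_mult rather than ring_1, because ring_1 contains
   the axiom 0 \<noteq> 1 and would exclude the zero ring. *)
class involution_ring = ring + monoid_mult +
  fixes star :: "'a \<Rightarrow> 'a"  ("(_\<^sup>\<star>)" [1000] 999)
  assumes star_star: "(a\<^sup>\<star>)\<^sup>\<star> = a"
    and star_mult: "(a * b)\<^sup>\<star> = b\<^sup>\<star> * a\<^sup>\<star>"
    and star_add: "(a + b)\<^sup>\<star> = a\<^sup>\<star> + b\<^sup>\<star>"

definition mp_invertibles :: "'a::involution_ring set" where
  "mp_invertibles =
    {a. \<exists>b. a * b * a = a \<and> b * a * b = b \<and> (a * b)\<^sup>\<star> = a * b \<and> (b * a)\<^sup>\<star> = b * a}"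

definition right_mults :: "'a::ring \<Rightarrow> 'a set" where
  "right_mults c = {c * x | x. True}"

definition left_mults :: "'a::ring \<Rightarrow> 'a set" where
  "left_mults c = {x * c | x. True}"

definition right_ann :: "'a::ring \<Rightarrow> 'a set" where
  "right_ann c = {x. c * x = 0}"

definition left_ann :: "'a::ring \<Rightarrow> 'a set" where
  "left_ann c = {x. x * c = 0}"

(* A + B is the elementwise sum of sets from Set_Algebras; for additive subgroups it is
   the sum of subgroups. *)
definition is_direct_sum :: "'a::ring set \<Rightarrow> 'a set \<Rightarrow> 'a set \<Rightarrow> bool" where
  "is_direct_sum M A B \<longleftrightarrow> M = A + B \<and> A \<inter> B = {0}"

end

theory Submission imports Defs begin

text \<open>
  If \<open>b\<close> is a Moore-Penrose inverse of \<open>a\<close>, then \<open>b * a\<close> is the projection along \<open>right_ann a\<close>, and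
  its range is the right ideal generated by \<open>(a\<^sup>\<star> * a) ^ n\<close>: one inclusion is the identity
  \<open>b * a = (a\<^sup>\<star> * a) ^ n * (b * b\<^sup>\<star>) ^ n\<close>, the other is \<open>b * a * a\<^sup>\<star> = a\<^sup>\<star>\<close>. The Peirce
  decomposition \<open>x = (x - b * a * x) + b * a * x\<close> is then the direct sum asked for.

  Conversely, writing \<open>1\<close> as a member of \<open>right_ann a + right_mults ((a\<^sup>\<star> * a) ^ n)\<close> and multiplying
  by \<open>a\<close> on the left gives \<open>a = a * a\<^sup>\<star> * a * w\<close> for some \<open>w\<close>. Everything needed for a Moore-Penrose
  inverse is contained in this single equation: \<open>p = a\<^sup>\<star> * a * w\<close> satisfies \<open>a * p = a\<close> and
  \<open>p\<^sup>\<star> * p = p\<^sup>\<star>\<close>, so it is a projection, and \<open>w\<^sup>\<star> * a\<^sup>\<star>\<close> is an inner inverse of \<open>a\<close> with both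
  symmetry properties (lemma \<open>mp_invertible_if_right_factor\<close>).

  This settles the two conditions on \<open>right_ann a\<close>. The remaining ones follow by symmetry:
  \<open>a\<close> is Moore-Penrose invertible if and only if \<open>a\<^sup>\<star>\<close> is, and the involution is an additive bijection
  that exchanges left and right annihilators and left and right principal ideals.
\<close>

lemma star_zero: "(0::'a::involution_ring)\<^sup>\<star> = 0"
  using star_add[of "0::'a" 0] by simp

lemma star_one: "(1::'a::involution_ring)\<^sup>\<star> = 1"
  by (metis mult_1_left mult_1_right star_mult star_star)

lemma star_power: "((c::'a::involution_ring) ^ n)\<^sup>\<star> = (c\<^sup>\<star>) ^ n"
  by (induction n) (simp_all add: star_one star_mult power_commutes)

lemma star_mp_invertible:
  fixes a :: "'a::involution_ring"
  assumes "a \<in> mp_invertibles"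
  shows "a\<^sup>\<star> \<in> mp_invertibles"
proof -
  from assms obtain b where "a * b * a = a" "b * a * b = b"
    "(a * b)\<^sup>\<star> = a * b" "(b * a)\<^sup>\<star> = b * a"
    unfolding mp_invertibles_def by blast
  then have "a\<^sup>\<star> * b\<^sup>\<star> * a\<^sup>\<star> = a\<^sup>\<star> \<and> b\<^sup>\<star> * a\<^sup>\<star> * b\<^sup>\<star> = b\<^sup>\<star>
      \<and> (a\<^sup>\<star> * b\<^sup>\<star>)\<^sup>\<star> = a\<^sup>\<star> * b\<^sup>\<star> \<and> (b\<^sup>\<star> * a\<^sup>\<star>)\<^sup>\<star> = b\<^sup>\<star> * a\<^sup>\<star>"
    by (metis star_mult mult.assoc)
  then show ?thesis
    unfolding mp_invertibles_def by blast
qed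

lemma star_mp_invertible_iff:
  "(a::'a::involution_ring)\<^sup>\<star> \<in> mp_invertibles \<longleftrightarrow> a \<in> mp_invertibles"
  by (metis star_mp_invertible star_star)

text \<open>
  With \<open>p = a\<^sup>\<star> * a * w\<close> the hypothesis reads \<open>a * p = a\<close>. Hence \<open>p\<^sup>\<star> * p = w\<^sup>\<star> * a\<^sup>\<star> * (a * p) = p\<^sup>\<star>\<close>,
  and since the left-hand side is symmetric, so is \<open>p\<close>. The candidate \<open>c = w\<^sup>\<star> * a\<^sup>\<star>\<close> then satisfies
  \<open>c * a = p\<close>, and \<open>p * a\<^sup>\<star> = a\<^sup>\<star>\<close> yields the symmetry of \<open>a * c\<close>. Only \<open>c * a * c = c\<close> can fail;
  the usual passage from an inner to a reflexive inverse, \<open>c * a * c = p * c\<close>, repairs this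
  without changing \<open>a * c\<close> and \<open>c * a\<close>.
\<close>

lemma mp_invertible_if_right_factor:
  fixes a w :: "'a::involution_ring"
  assumes factor: "a = a * a\<^sup>\<star> * a * w"
  shows "a \<in> mp_invertibles"
proof -
  define p where "p = a\<^sup>\<star> * a * w"
  have ap: "a * p = a"
    using factor by (simp add: p_def mult.assoc)
  have star_p: "p\<^sup>\<star> = w\<^sup>\<star> * a\<^sup>\<star> * a"
    by (simp add: p_def star_mult star_star mult.assoc)
  have "p\<^sup>\<star> * p = p\<^sup>\<star>"
    by (simp add: star_p mult.assoc ap)
  then have p_sym: "p\<^sup>\<star> = p"
    by (metis star_mult star_star)
  with \<open>p\<^sup>\<star> * p = p\<^sup>\<star>\<close> have pp: "p * p = p"
    by simp
  have p_star_a: "p * a\<^sup>\<star> = a\<^sup>\<star>"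
    by (metis ap p_sym star_mult)
  define c where "c = w\<^sup>\<star> * a\<^sup>\<star>"
  have ca: "c * a = p"
    using star_p p_sym by (simp add: c_def mult.assoc)
  \<comment> \<open>\<open>a * c\<close> is \<open>a * w\<^sup>\<star> * a\<^sup>\<star>\<close>, so it is symmetric once the star can be moved off \<open>w\<close>\<close>
  have "a * c = a * w\<^sup>\<star> * (p * a\<^sup>\<star>)"
    by (simp add: c_def p_star_a mult.assoc)
  also have "\<dots> = a * (c * a) * w * a\<^sup>\<star>"
    by (simp add: c_def p_def mult.assoc)
  also have "\<dots> = a * w * a\<^sup>\<star>"
    by (simp add: ca ap)
  finally have ac: "a * c = a * w * a\<^sup>\<star>" .
  have ac_sym: "(a * c)\<^sup>\<star> = a * c"
    by (metis ac c_def mult.assoc star_mult star_star)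
  have "a * (p * c) = a * c"
    by (metis ap mult.assoc)
  moreover have "(p * c) * a = p"
    by (simp add: mult.assoc ca pp)
  ultimately have "a * (p * c) * a = a \<and> (p * c) * a * (p * c) = p * c
      \<and> (a * (p * c))\<^sup>\<star> = a * (p * c) \<and> ((p * c) * a)\<^sup>\<star> = (p * c) * a"
    using ac_sym p_sym ap ca pp by (metis mult.assoc)
  then show ?thesis
    unfolding mp_invertibles_def by blast
qed

lemma mp_invertible_if_right_sum:
  fixes a :: "'a::involution_ring"
  assumes "n > 0" and sum: "UNIV = right_ann a + right_mults ((a\<^sup>\<star> * a) ^ n)"
  shows "a \<in> mp_invertibles"
proof -
  from sum have "1 \<in> right_ann a + right_mults ((a\<^sup>\<star> * a) ^ n)"
    by blast
  then obtain u v where au: "a * u = 0" and one: "1 = u + (a\<^sup>\<star> * a) ^ n * v"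
    unfolding right_ann_def right_mults_def by (auto elim!: set_plus_elim)
  obtain m where n: "n = Suc m"
    using \<open>n > 0\<close> gr0_implies_Suc by blast
  have "a = a * (u + (a\<^sup>\<star> * a) ^ n * v)"
    by (simp flip: one)
  also have "\<dots> = a * a\<^sup>\<star> * a * ((a\<^sup>\<star> * a) ^ m * v)"
    by (simp add: distrib_left au n mult.assoc)
  finally show ?thesis
    by (rule mp_invertible_if_right_factor)
qed

text \<open>
  For \<open>n = 1\<close> this is \<open>b * a = a\<^sup>\<star> * b\<^sup>\<star>\<close> with \<open>b\<^sup>\<star> = a * b * b\<^sup>\<star>\<close> substituted. The powers
  accumulate because \<open>b * a\<close> is absorbed by \<open>a\<close>.
\<close>

lemma mp_projection_eq_power_mult:
  fixes a b :: "'a::involution_ring"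
  assumes aba: "a * b * a = a" and bab: "b * a * b = b"
    and ab_sym: "(a * b)\<^sup>\<star> = a * b" and ba_sym: "(b * a)\<^sup>\<star> = b * a"
  shows "b * a = (a\<^sup>\<star> * a) ^ Suc m * (b * b\<^sup>\<star>) ^ Suc m"
proof -
  have "b\<^sup>\<star> = a * b * b\<^sup>\<star>"
    by (metis bab ab_sym star_mult mult.assoc)
  then have base: "b * a = a\<^sup>\<star> * a * (b * b\<^sup>\<star>)"
    by (metis ba_sym star_mult mult.assoc)
  show ?thesis
  proof (induction m)
    case 0
    show ?case
      using base by simp
  next
    case (Suc m)
    have "(a\<^sup>\<star> * a) ^ Suc (Suc m) * (b * b\<^sup>\<star>) ^ Suc (Suc m)
        = a\<^sup>\<star> * a * ((a\<^sup>\<star> * a) ^ Suc m * (b * b\<^sup>\<star>) ^ Suc m) * (b * b\<^sup>\<star>)"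
      by (simp only: power_Suc[of "a\<^sup>\<star> * a" "Suc m"] power_Suc2[of "b * b\<^sup>\<star>" "Suc m"] mult.assoc)
    also have "\<dots> = a\<^sup>\<star> * (a * b * a) * (b * b\<^sup>\<star>)"
      unfolding Suc.IH[symmetric] by (simp add: mult.assoc)
    also have "\<dots> = b * a"
      by (simp add: aba base)
    finally show ?case ..
  qed
qed

lemma right_direct_sum_if_mp_invertible:
  fixes a :: "'a::involution_ring"
  assumes "n > 0" and mp: "a \<in> mp_invertibles"
  shows "is_direct_sum UNIV (right_ann a) (right_mults ((a\<^sup>\<star> * a) ^ n))"
proof -
  from mp obtain b where b: "a * b * a = a" "b * a * b = b"
    "(a * b)\<^sup>\<star> = a * b" "(b * a)\<^sup>\<star> = b * a"
    unfolding mp_invertibles_def by blast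
  obtain m where n: "n = Suc m"
    using \<open>n > 0\<close> gr0_implies_Suc by blast
  have ba: "b * a = (a\<^sup>\<star> * a) ^ n * (b * b\<^sup>\<star>) ^ n"
    unfolding n using b by (rule mp_projection_eq_power_mult)
  have "x \<in> right_ann a + right_mults ((a\<^sup>\<star> * a) ^ n)" for x
  proof -
    have "a * (x - b * a * x) = 0"
      by (simp add: right_diff_distrib b(1) flip: mult.assoc)
    then have "x - b * a * x \<in> right_ann a"
      by (simp add: right_ann_def)
    moreover have "b * a * x \<in> right_mults ((a\<^sup>\<star> * a) ^ n)"
      unfolding right_mults_def ba mult.assoc by blast
    ultimately have "(x - b * a * x) + b * a * x \<in> right_ann a + right_mults ((a\<^sup>\<star> * a) ^ n)"
      by (rule set_plus_intro)
    then show ?thesis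
      by simp
  qed
  moreover have "x = 0" if "x \<in> right_ann a" "x \<in> right_mults ((a\<^sup>\<star> * a) ^ n)" for x
  proof -
    from that obtain y where ax: "a * x = 0" and x: "x = (a\<^sup>\<star> * a) ^ n * y"
      unfolding right_ann_def right_mults_def by blast
    have "b * a * a\<^sup>\<star> = a\<^sup>\<star>"
      by (metis b(1,4) star_mult mult.assoc)
    \<comment> \<open>so \<open>b * a\<close> fixes every element of the right ideal, whereas it kills \<open>right_ann a\<close>\<close>
    then have "b * a * x = x"
      by (simp add: x n flip: mult.assoc)
    then show ?thesis
      by (simp add: mult.assoc ax)
  qed
  moreover have "0 \<in> right_ann a" "0 \<in> right_mults ((a\<^sup>\<star> * a) ^ n)"
    unfolding right_ann_def right_mults_def by (auto intro: exI[of _ 0])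
  ultimately show ?thesis
    unfolding is_direct_sum_def by blast
qed

lemma mp_invertible_iff_right_direct_sum:
  fixes a :: "'a::involution_ring"
  assumes "n > 0"
  shows "a \<in> mp_invertibles \<longleftrightarrow> is_direct_sum UNIV (right_ann a) (right_mults ((a\<^sup>\<star> * a) ^ n))"
    and "a \<in> mp_invertibles \<longleftrightarrow> UNIV = right_ann a + right_mults ((a\<^sup>\<star> * a) ^ n)"
  using right_direct_sum_if_mp_invertible[OF assms] mp_invertible_if_right_sum[OF assms]
  unfolding is_direct_sum_def by blast+

lemma star_image_left_ann: "star ` left_ann (c::'a::involution_ring) = right_ann (c\<^sup>\<star>)"
proof -
  have "x\<^sup>\<star> \<in> right_ann (c\<^sup>\<star>)" if "x \<in> left_ann c" for x
    using that by (simp add: left_ann_def right_ann_def star_zero flip: star_mult)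
  moreover have "x\<^sup>\<star> \<in> left_ann c" if "x \<in> right_ann (c\<^sup>\<star>)" for x
    using that unfolding left_ann_def right_ann_def mem_Collect_eq
    by (metis star_mult star_star star_zero)
  ultimately show ?thesis
    by (metis image_eqI image_subsetI star_star subsetI subset_antisym)
qed

lemma star_image_left_mults: "star ` left_mults (c::'a::involution_ring) = right_mults (c\<^sup>\<star>)"
proof -
  have "x\<^sup>\<star> \<in> right_mults (c\<^sup>\<star>)" if "x \<in> left_mults c" for x
    using that by (auto simp: left_mults_def right_mults_def star_mult)
  moreover have "x\<^sup>\<star> \<in> left_mults c" if "x \<in> right_mults (c\<^sup>\<star>)" for x
    using that by (auto simp: left_mults_def right_mults_def star_mult star_star)
  ultimately show ?thesis
    by (metis image_eqI image_subsetI star_star subsetI subset_antisym)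
qed

lemma bij_star: "bij (star :: 'a::involution_ring \<Rightarrow> 'a)"
  by (rule o_bij[where g = star]) (auto simp: star_star)

lemma star_image_plus: "star ` (A + B) = star ` A + star ` (B :: 'a::involution_ring set)"
  by (force simp: set_plus_def star_add)

lemma star_image_UNIV_sum_iff:
  "UNIV = star ` A + star ` B \<longleftrightarrow> UNIV = A + (B :: 'a::involution_ring set)"
  using bij_star[where 'a = 'a]
  by (metis star_image_plus bij_is_inj bij_is_surj inj_image_eq_iff)

lemma star_image_direct_sum_iff:
  "is_direct_sum UNIV (star ` A) (star ` B) \<longleftrightarrow> is_direct_sum UNIV A (B :: 'a::involution_ring set)"
proof -
  have inj: "inj (star :: 'a \<Rightarrow> 'a)"
    by (rule bij_is_inj[OF bij_star])
  have "star ` A \<inter> star ` B = {0} \<longleftrightarrow> star ` (A \<inter> B) = star ` {0}"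
    by (simp add: image_Int[OF inj] star_zero)
  also have "\<dots> \<longleftrightarrow> A \<inter> B = {0}"
    by (rule inj_image_eq_iff[OF inj])
  finally show ?thesis
    by (simp add: is_direct_sum_def star_image_UNIV_sum_iff)
qed

text \<open>
  The powers of \<open>a\<^sup>\<star> * a\<close> are symmetric, so the involution carries the left ideal generated by such
  a power to the right ideal with the same generator, and \<open>left_ann (a\<^sup>\<star>)\<close> to \<open>right_ann a\<close>.
\<close>

lemma mp_invertible_iff_left_direct_sum:
  fixes a :: "'a::involution_ring"
  assumes "n > 0"
  shows "a \<in> mp_invertibles \<longleftrightarrow> is_direct_sum UNIV (left_ann (a\<^sup>\<star>)) (left_mults ((a\<^sup>\<star> * a) ^ n))"
    and "a \<in> mp_invertibles \<longleftrightarrow> UNIV = left_ann (a\<^sup>\<star>) + left_mults ((a\<^sup>\<star> * a) ^ n)"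
proof -
  have ann: "star ` left_ann (a\<^sup>\<star>) = right_ann a"
    by (simp add: star_image_left_ann star_star)
  have mults: "star ` left_mults ((a\<^sup>\<star> * a) ^ n) = right_mults ((a\<^sup>\<star> * a) ^ n)"
    by (simp add: star_image_left_mults star_power star_mult star_star)
  show "a \<in> mp_invertibles \<longleftrightarrow> is_direct_sum UNIV (left_ann (a\<^sup>\<star>)) (left_mults ((a\<^sup>\<star> * a) ^ n))"
    using mp_invertible_iff_right_direct_sum(1)[OF assms, of a]
    unfolding ann[symmetric] mults[symmetric] star_image_direct_sum_iff .
  show "a \<in> mp_invertibles \<longleftrightarrow> UNIV = left_ann (a\<^sup>\<star>) + left_mults ((a\<^sup>\<star> * a) ^ n)"
    using mp_invertible_iff_right_direct_sum(2)[OF assms, of a]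
    unfolding ann[symmetric] mults[symmetric] star_image_UNIV_sum_iff .
qed

theorem theorem3p11:
  fixes a :: "'a::involution_ring" and n :: nat
  assumes "n > 0"
  shows "(a \<in> mp_invertibles \<longleftrightarrow> is_direct_sum UNIV (right_ann a) (right_mults ((a\<^sup>\<star> * a) ^ n)))
    \<and> (a \<in> mp_invertibles \<longleftrightarrow> UNIV = right_ann a + right_mults ((a\<^sup>\<star> * a) ^ n))
    \<and> (a \<in> mp_invertibles \<longleftrightarrow> is_direct_sum UNIV (right_ann (a\<^sup>\<star>)) (right_mults ((a * a\<^sup>\<star>) ^ n)))
    \<and> (a \<in> mp_invertibles \<longleftrightarrow> UNIV = right_ann (a\<^sup>\<star>) + right_mults ((a * a\<^sup>\<star>) ^ n))
    \<and> (a \<in> mp_invertibles \<longleftrightarrow> is_direct_sum UNIV (left_ann a) (left_mults ((a * a\<^sup>\<star>) ^ n)))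
    \<and> (a \<in> mp_invertibles \<longleftrightarrow> UNIV = left_ann a + left_mults ((a * a\<^sup>\<star>) ^ n))
    \<and> (a \<in> mp_invertibles \<longleftrightarrow> is_direct_sum UNIV (left_ann (a\<^sup>\<star>)) (left_mults ((a\<^sup>\<star> * a) ^ n)))
    \<and> (a \<in> mp_invertibles \<longleftrightarrow> UNIV = left_ann (a\<^sup>\<star>) + left_mults ((a\<^sup>\<star> * a) ^ n))"
  using mp_invertible_iff_right_direct_sum[OF assms, of a]
    mp_invertible_iff_right_direct_sum[OF assms, of "a\<^sup>\<star>"]
    mp_invertible_iff_left_direct_sum[OF assms, of a]
    mp_invertible_iff_left_direct_sum[OF assms, of "a\<^sup>\<star>"]
  unfolding star_star star_mp_invertible_iff by (intro conjI)

end
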